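(* Fix $t\ge 1$, $\Delta\ge 0$ and a sample index $j$, and let the states take values in a finite set $\mathcal{A}=\{a_1,\dots,a_{|\mathcal{A}|}\}$. Let $(\mathbf{x}_{t-1}^{(j)},w_{t-1}^{(j)})$ be properly weighted with respect to $\pi_{t-1}(\mathbf{x}_{t-1})$. Let $$w_t^{(1,j)}=w_{t-1}^{(j)}\,\frac{\pi_{t+\Delta}(\mathbf{x}_{t-1}^{(j)})}{\pi_{t-1}(\mathbf{x}_{t-1}^{(j)})}$$ be the weight of the sample generated by the exact lookahead sampling algorithm, i.e. of $(\mathbf{x}_{t-1}^{(j)},x_t^{(1,j)})$ with $x_t^{(1,j)}\sim\pi_{t+\Delta}(x_t\mid\mathbf{x}_{t-1}^{(j)})$. For $K\ge1$ let $U_t^{(j,i,k)}$ ($i=1,\dots,|\mathcal{A}|$, $k=1,\dots,K$) be the cumulative incremental weights and $$w_t^{\mathrm{aux}(j)}=w_{t-1}^{(j)}\sum_{i=1}^{|\mathcal{A}|}\frac1K\sum_{k=1}^K U_t^{(j,i,k)}$$ the auxiliary weight of the $K$-pilot lookahead algorithm (described in the context). Then $$0\ \le\ \operatorname{var}_{\pi_{t+\Delta}}\big(w_t^{\mathrm{aux}(j)}\big)-\operatorname{var}_{\pi_{t+\Delta}}\big(w_t^{(1,j)}\big)\ =\ O(1/K)\qquad (K\to\infty),$$ and, for every function $h$ of $\mathbf{x}_t$, $$0\ \le\ \operatorname{var}_{\pi_{t+\Delta}}\Big[w_{t-1}^{(j)}\sum_{i=1}^{|\mathcal{A}|}\frac1K\sum_{k=1}^K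 U_t^{(j,i,k)}h\big(\mathbf{x}_{t-1}^{(j)},x_t=a_i\big)\Big]-\operatorname{var}_{\pi_{t+\Delta}}\Big[w_t^{(1,j)}E_{\pi_{t+\Delta}}\big(h(\mathbf{x}_t)\mid\mathbf{x}_{t-1}=\mathbf{x}_{t-1}^{(j)}\big)\Big]\ =\ O(1/K)\qquad (K\to\infty).$$
   Context: Latent states $x_0,x_1,\dots$ taking values in the finite set $\mathcal{A}$ and observations $y_1,y_2,\dots$ have a joint distribution (with densities/mass functions). Write $\mathbf{x}_t=(x_0,\dots,x_t)$, $\mathbf{y}_t=(y_1,\dots,y_t)$, $\pi_t(\mathbf{x}_t)=p(\mathbf{x}_t\mid\mathbf{y}_t)$; for any $s,t$ let $\pi_t(\mathbf{x}_s)=p(\mathbf{x}_s\mid\mathbf{y}_t)$ and $\pi_t(x_s\mid\mathbf{x}_{s-1})=p(x_s\mid\mathbf{x}_{s-1},\mathbf{y}_t)$. The subscript $\pi_{t+\Delta}$ on $\operatorname{var}$ and $E$ means that the operation is conditional on $\mathbf{y}_{t+\Delta}$. In particular $E_{\pi_{t+\Delta}}(h(\mathbf{x}_t)\mid\mathbf{x}_{t-1}=\mathbf{x}_{t-1}^{(j)})=\sum_{i}h(\mathbf{x}_{t-1}^{(j)},x_t=a_i)\,\pi_{t+\Delta}(x_t=a_i\mid\mathbf{x}_{t-1}^{(j)})$. Properly weighted: a random pair $(\mathbf{x},w)$ with $w\ge 0$ is properly weighted with respect to $\pi$ if $E[w\,h(\mathbf{x})]=E_\pi[h(\mathbf{x})]$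 for every $\pi$-integrable $h$ (e.g. $\mathbf{x}\sim r$, $w=\pi(\mathbf{x})/r(\mathbf{x})$, support of $r$ covering that of $\pi$). The weight $w_{t-1}^{(j)}$ has finite second moment. $K$-pilot lookahead algorithm at time $t$: given $(\mathbf{x}_{t-1}^{(j)},w_{t-1}^{(j)})$, for each $i=1,\dots,|\mathcal{A}|$ and $k=1,\dots,K$ independently, draw a pilot path $\mathbf{x}_{t+1:t+\Delta}^{(j,i,k)}=(x_{t+1}^{(j,i,k)},\dots,x_{t+\Delta}^{(j,i,k)})$ from $$\prod_{s=t+1}^{t+\Delta}q_s^{\mathrm{pilot}}\big(x_s\mid\mathbf{x}_{t-1}^{(j)},x_t=a_i,\mathbf{x}_{t+1:s-1}\big)$$ (the $q_s^{\mathrm{pilot}}$ being given conditional distributions, not depending on $K$, whose product has support covering that of the conditional distribution of $(x_{t+1},\dots,x_{t+\Delta})$ given $\mathbf{x}_t$ under $\pi_{t+\Delta}$; $\mathbf{x}_{a:b}=(x_a,\dots,x_b)$), and set $$U_t^{(j,i,k)}=\frac{\pi_{t+\Delta}\big(\mathbf{x}_{t-1}^{(j)},x_t=a_i,\mathbf{x}_{t+1:t+\Delta}^{(j,i,k)}\big)}{\pi_{t-1}\big(\mathbf{x}_{t-1}^{(j)}\big)\prod_{s=t+1}^{t+\Delta}q_s^{\mathrm{pilot}}\big(x_s^{(j,i,k)}\mid\mathbf{x}_{t-1}^{(j)},x_t=a_i,\mathbf{x}_{t+1:s-1}^{(j,i,k)}\big)} .$$ The new state $x_t^{(j)}$ is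 then drawn with probabilities proportional to $\sum_{k=1}^K U_t^{(j,i,k)}$, $i=1,\dots,|\mathcal{A}|$. Ratios with zero numerator are read as $0$. *)

theory Defs
  imports "HOL-Probability.Probability" "HOL-Library.Landau_Symbols"
begin

text \<open>State paths are lists: \<open>(x\<^sub>0, \<dots>, x\<^sub>s)\<close> is an element of \<open>paths A (s + 1)\<close>, and
  a pilot segment \<open>(x\<^sub>t\<^sub>+\<^sub>1, \<dots>, x\<^sub>t\<^sub>+\<^sub>\<Delta>)\<close> is an element of \<open>paths A \<Delta>\<close>.\<close>

definition paths :: "'a set \<Rightarrow> nat \<Rightarrow> 'a list set" where
  "paths A n = {xs. set xs \<subseteq> A \<and> length xs = n}"

text \<open>\<open>p n\<close> is the joint density of \<open>(x\<^sub>0, \<dots>, x\<^sub>n, y\<^sub>1, \<dots>, y\<^sub>n)\<close> with respect to counting measure on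
  the states and reference measures \<open>\<nu> s\<close> for the observations. No Markov structure is assumed.\<close>

locale state_space_model = prob_space M
  for M :: "'w measure" +
  fixes A :: "'a set"
    and \<nu> :: "nat \<Rightarrow> 'y measure"
    and X :: "nat \<Rightarrow> 'w \<Rightarrow> 'a"
    and Y :: "nat \<Rightarrow> 'w \<Rightarrow> 'y"
    and p :: "nat \<Rightarrow> 'a list \<Rightarrow> (nat \<Rightarrow> 'y) \<Rightarrow> real"
  assumes finite_states: "finite A"
    and sigma_finite_reference: "sigma_finite_measure (\<nu> s)"
    and density_nonneg:
      "\<lbrakk>x \<in> paths A (n + 1); y \<in> space (PiM {1..n} \<nu>)\<rbrakk> \<Longrightarrow> 0 \<le> p n x y"
    and joint_density:
      "distributed M (count_space (paths A (n + 1)) \<Otimes>\<^sub>M PiM {1..n} \<nu>)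
         (\<lambda>\<omega>. (map (\<lambda>s. X s \<omega>) [0..<n + 1], \<lambda>s\<in>{1..n}. Y s \<omega>))
         (\<lambda>(x, y). ennreal (p n x y))"

text \<open>In what follows \<open>y\<close> is the fixed observation record; only \<open>y 1, \<dots>, y n\<close> enter at time \<open>n\<close>.\<close>

definition obs_density ::
  "'a set \<Rightarrow> (nat \<Rightarrow> 'a list \<Rightarrow> (nat \<Rightarrow> 'y) \<Rightarrow> real) \<Rightarrow> (nat \<Rightarrow> 'y) \<Rightarrow> nat \<Rightarrow> real" where
  "obs_density A p y n = (\<Sum>x\<in>paths A (n + 1). p n x (restrict y {1..n}))"

text \<open>\<open>\<pi>\<^sub>n(x\<^sub>0, \<dots>, x\<^sub>s) = p(x\<^sub>0, \<dots>, x\<^sub>s | y\<^sub>1, \<dots>, y\<^sub>n)\<close> for \<open>s \<le> n\<close>, with \<open>s + 1 = length x\<close>: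
  the later states \<open>x\<^sub>s\<^sub>+\<^sub>1, \<dots>, x\<^sub>n\<close> are summed out.\<close>

definition post ::
  "'a set \<Rightarrow> (nat \<Rightarrow> 'a list \<Rightarrow> (nat \<Rightarrow> 'y) \<Rightarrow> real) \<Rightarrow> (nat \<Rightarrow> 'y) \<Rightarrow> nat \<Rightarrow> 'a list \<Rightarrow> real" where
  "post A p y n x =
     (\<Sum>z\<in>paths A (n + 1 - length x). p n (x @ z) (restrict y {1..n})) / obs_density A p y n"

text \<open>\<open>\<pi>\<^sub>n(z | x)\<close>: conditional probability that the path \<open>x\<close> continues with the segment \<open>z\<close>.\<close>

definition post_cond ::
  "'a set \<Rightarrow> (nat \<Rightarrow> 'a list \<Rightarrow> (nat \<Rightarrow> 'y) \<Rightarrow> real) \<Rightarrow> (nat \<Rightarrow> 'y) \<Rightarrow> nat \<Rightarrow> 'a list \<Rightarrow> 'a list \<Rightarrow> real" where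
  "post_cond A p y n x z = post A p y n (x @ z) / post A p y n x"

text \<open>The target is given by its mass function \<open>\<pi>\<close> on the set \<open>S\<close>. The integrability of
  \<open>W * h(X)\<close> is the existence of the expectation (\<open>integral\<close> is 0 otherwise).\<close>

definition properly_weighted ::
  "'v measure \<Rightarrow> 'b set \<Rightarrow> ('b \<Rightarrow> real) \<Rightarrow> ('v \<Rightarrow> 'b) \<Rightarrow> ('v \<Rightarrow> real) \<Rightarrow> bool" where
  "properly_weighted P S \<pi> X W \<longleftrightarrow>
     X \<in> P \<rightarrow>\<^sub>M count_space S \<and> W \<in> borel_measurable P \<and> (AE \<omega> in P. 0 \<le> W \<omega>) \<and>
     (\<forall>h :: 'b \<Rightarrow> real. integrable (point_measure S (\<lambda>x. ennreal (\<pi> x))) h \<longrightarrow>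
        integrable P (\<lambda>\<omega>. W \<omega> * h (X \<omega>)) \<and>
        (\<integral>\<omega>. W \<omega> * h (X \<omega>) \<partial>P) = (\<integral>x. h x \<partial>point_measure S (\<lambda>x. ennreal (\<pi> x))))"

text \<open>\<open>q s (x\<^sub>0, \<dots>, x\<^sub>s\<^sub>-\<^sub>1)\<close> is the pilot proposal for \<open>x\<^sub>s\<close>. Below \<open>x = (x\<^sub>0, \<dots>, x\<^sub>t)\<close> and
  \<open>z = (x\<^sub>t\<^sub>+\<^sub>1, \<dots>, x\<^sub>t\<^sub>+\<^sub>\<Delta>)\<close>, so that \<open>x\<^sub>s = z ! (s - t - 1)\<close>.\<close>

definition pilot_prob ::
  "(nat \<Rightarrow> 'a list \<Rightarrow> 'a pmf) \<Rightarrow> nat \<Rightarrow> nat \<Rightarrow> 'a list \<Rightarrow> 'a list \<Rightarrow> real" where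
  "pilot_prob q t \<Delta> x z =
     (\<Prod>s = t + 1..t + \<Delta>. pmf (q s (x @ take (s - t - 1) z)) (z ! (s - t - 1)))"

definition pilot_proposal ::
  "'a set \<Rightarrow> (nat \<Rightarrow> 'a list \<Rightarrow> (nat \<Rightarrow> 'y) \<Rightarrow> real) \<Rightarrow> (nat \<Rightarrow> 'y) \<Rightarrow> nat \<Rightarrow> nat
     \<Rightarrow> (nat \<Rightarrow> 'a list \<Rightarrow> 'a pmf) \<Rightarrow> bool" where
  "pilot_proposal A p y t \<Delta> q \<longleftrightarrow>
     (\<forall>s\<in>{t + 1..t + \<Delta>}. \<forall>x\<in>paths A s. set_pmf (q s x) \<subseteq> A) \<and>
     (\<forall>x\<in>paths A (t + 1). \<forall>z\<in>paths A \<Delta>.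
        0 < post A p y (t + \<Delta>) x \<longrightarrow> 0 < post_cond A p y (t + \<Delta>) x z \<longrightarrow> 0 < pilot_prob q t \<Delta> x z)"

text \<open>\<open>Z i k\<close> is the pilot segment started from \<open>x\<^sub>t = a i\<close>. The product formula says that,
  conditionally on \<open>(X, W)\<close>, the \<open>Z i k\<close> are independent with mass functions
  \<open>pilot_prob q t \<Delta> (X @ [a i])\<close>.\<close>

definition pilot_draws ::
  "'v measure \<Rightarrow> 'a set \<Rightarrow> (nat \<Rightarrow> 'a) \<Rightarrow> (nat \<Rightarrow> 'a list \<Rightarrow> 'a pmf) \<Rightarrow> nat \<Rightarrow> nat
     \<Rightarrow> ('v \<Rightarrow> 'a list) \<Rightarrow> ('v \<Rightarrow> real) \<Rightarrow> nat \<Rightarrow> (nat \<Rightarrow> nat \<Rightarrow> 'v \<Rightarrow> 'a list) \<Rightarrow> bool" where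
  "pilot_draws P A a q t \<Delta> X W K Z \<longleftrightarrow>
     (\<forall>i\<in>{1..card A}. \<forall>k\<in>{1..K}. Z i k \<in> P \<rightarrow>\<^sub>M count_space (paths A \<Delta>)) \<and>
     (\<forall>x\<in>paths A t. \<forall>B\<in>sets borel. \<forall>z. (\<forall>i\<in>{1..card A}. \<forall>k\<in>{1..K}. z i k \<in> paths A \<Delta>) \<longrightarrow>
        measure P {\<omega> \<in> space P. X \<omega> = x \<and> W \<omega> \<in> B \<and>
                     (\<forall>i\<in>{1..card A}. \<forall>k\<in>{1..K}. Z i k \<omega> = z i k)}
        = measure P {\<omega> \<in> space P. X \<omega> = x \<and> W \<omega> \<in> B}
          * (\<Prod>i = 1..card A. \<Prod>k = 1..K. pilot_prob q t \<Delta> (x @ [a i]) (z i k)))"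

text \<open>Cumulative incremental weight \<open>U\<close> of the pilot path \<open>(x, b, z)\<close>, where \<open>x = (x\<^sub>0, \<dots>, x\<^sub>t\<^sub>-\<^sub>1)\<close>
  and \<open>x\<^sub>t = b\<close>. As \<open>0 / 0 = 0\<close>, ratios with zero numerator are 0.\<close>

definition incr_weight ::
  "'a set \<Rightarrow> (nat \<Rightarrow> 'a list \<Rightarrow> (nat \<Rightarrow> 'y) \<Rightarrow> real) \<Rightarrow> (nat \<Rightarrow> 'y) \<Rightarrow> (nat \<Rightarrow> 'a list \<Rightarrow> 'a pmf)
     \<Rightarrow> nat \<Rightarrow> nat \<Rightarrow> 'a list \<Rightarrow> 'a \<Rightarrow> 'a list \<Rightarrow> real" where
  "incr_weight A p y q t \<Delta> x b z =
     post A p y (t + \<Delta>) (x @ [b] @ z) / (post A p y (t - 1) x * pilot_prob q t \<Delta> (x @ [b]) z)"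

definition lookahead_weight ::
  "'a set \<Rightarrow> (nat \<Rightarrow> 'a list \<Rightarrow> (nat \<Rightarrow> 'y) \<Rightarrow> real) \<Rightarrow> (nat \<Rightarrow> 'y) \<Rightarrow> nat \<Rightarrow> nat
     \<Rightarrow> ('v \<Rightarrow> 'a list) \<Rightarrow> ('v \<Rightarrow> real) \<Rightarrow> 'v \<Rightarrow> real" where
  "lookahead_weight A p y t \<Delta> X W \<omega> =
     W \<omega> * (post A p y (t + \<Delta>) (X \<omega>) / post A p y (t - 1) (X \<omega>))"

text \<open>\<open>E(h(x\<^sub>0, \<dots>, x\<^sub>t) | (x\<^sub>0, \<dots>, x\<^sub>t\<^sub>-\<^sub>1) = x)\<close> under \<open>\<pi>\<^sub>n\<close>.\<close>

definition cond_expect ::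
  "'a set \<Rightarrow> (nat \<Rightarrow> 'a list \<Rightarrow> (nat \<Rightarrow> 'y) \<Rightarrow> real) \<Rightarrow> (nat \<Rightarrow> 'y) \<Rightarrow> (nat \<Rightarrow> 'a) \<Rightarrow> nat
     \<Rightarrow> ('a list \<Rightarrow> real) \<Rightarrow> 'a list \<Rightarrow> real" where
  "cond_expect A p y a n h x = (\<Sum>i = 1..card A. h (x @ [a i]) * post_cond A p y n x [a i])"

definition aux_weight ::
  "'a set \<Rightarrow> (nat \<Rightarrow> 'a list \<Rightarrow> (nat \<Rightarrow> 'y) \<Rightarrow> real) \<Rightarrow> (nat \<Rightarrow> 'y) \<Rightarrow> (nat \<Rightarrow> 'a)
     \<Rightarrow> (nat \<Rightarrow> 'a list \<Rightarrow> 'a pmf) \<Rightarrow> nat \<Rightarrow> nat \<Rightarrow> ('v \<Rightarrow> 'a list) \<Rightarrow> ('v \<Rightarrow> real)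
     \<Rightarrow> nat \<Rightarrow> (nat \<Rightarrow> nat \<Rightarrow> 'v \<Rightarrow> 'a list) \<Rightarrow> 'v \<Rightarrow> real" where
  "aux_weight A p y a q t \<Delta> X W K Z \<omega> =
     W \<omega> * (\<Sum>i = 1..card A. 1 / real K *
       (\<Sum>k = 1..K. incr_weight A p y q t \<Delta> (X \<omega>) (a i) (Z i k \<omega>)))"

definition aux_estimate ::
  "'a set \<Rightarrow> (nat \<Rightarrow> 'a list \<Rightarrow> (nat \<Rightarrow> 'y) \<Rightarrow> real) \<Rightarrow> (nat \<Rightarrow> 'y) \<Rightarrow> (nat \<Rightarrow> 'a)
     \<Rightarrow> (nat \<Rightarrow> 'a list \<Rightarrow> 'a pmf) \<Rightarrow> nat \<Rightarrow> nat \<Rightarrow> ('v \<Rightarrow> 'a list) \<Rightarrow> ('v \<Rightarrow> real)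
     \<Rightarrow> nat \<Rightarrow> (nat \<Rightarrow> nat \<Rightarrow> 'v \<Rightarrow> 'a list) \<Rightarrow> ('a list \<Rightarrow> real) \<Rightarrow> 'v \<Rightarrow> real" where
  "aux_estimate A p y a q t \<Delta> X W K Z h \<omega> =
     W \<omega> * (\<Sum>i = 1..card A. 1 / real K *
       (\<Sum>k = 1..K. incr_weight A p y q t \<Delta> (X \<omega>) (a i) (Z i k \<omega>) * h (X \<omega> @ [a i])))"

end

theory Submission
  imports Defs
begin

text \<open>Conditionally on the sample path and its weight, the pilot estimate is \<open>W\<close> times a sum of
  independent terms whose conditional mean is the exact lookahead quantity. The excess variance
  is therefore the expected conditional variance, which equals \<open>C / K\<close> for a constant
  \<open>C \<ge> 0\<close>.\<close>

text \<open>The weight \<open>W\<close> has an arbitrary real law, possibly dependent on the path,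
  while paths and pilots take finitely many values. Conditioning is therefore carried out by hand:
  the product formula in \<open>pilot_draws\<close> is an equality of finite measures in the Borel
  set \<open>B\<close>, so it passes to integrals of functions of \<open>W\<close>, and all the rest
  is finite summation. Integrability is then a question about \<open>W\<close> and its square only.
  The rate has a simple source: an incremental weight enters with factor 1/K and so contributes its
  conditional variance divided by the square of K, and each candidate state has K of them. The
  numerator C is the expectation of the squared weight times the variances of single pilots, scaled
  by the squares of \<open>h\<close>. It involves \<open>Xs\<close>, \<open>W\<close> and
  \<open>q\<close> but not the draws, so one constant serves every K. The delicate points are
  divisions by zero: a path of zero posterior mass has conditional probabilities 0/0, and such paths
  must be seen to contribute zero on both sides.\<close>

section \<open>State paths and the law of a pilot\<close>

lemma finite_paths: "finite A \<Longrightarrow> finite (paths A n)"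
  unfolding paths_def by (rule finite_lists_length_eq)

lemma paths_0 [simp]: "paths A 0 = {[]}"
  by (auto simp: paths_def)

lemma append_in_paths: "x \<in> paths A m \<Longrightarrow> z \<in> paths A n \<Longrightarrow> x @ z \<in> paths A (m + n)"
  by (auto simp: paths_def)

lemma sum_paths_Cons:
  "(\<Sum>z\<in>paths A (Suc n). f z) = (\<Sum>b\<in>A. \<Sum>z\<in>paths A n. f (b # z))"
proof -
  have eq: "paths A (Suc n) = (\<lambda>(b, z). b # z) ` (A \<times> paths A n)"
    by (force simp: paths_def length_Suc_conv image_iff)
  have "(\<Sum>z\<in>paths A (Suc n). f z) = (\<Sum>(b, z)\<in>A \<times> paths A n. f (b # z))"
    unfolding eq by (subst sum.reindex) (auto simp: inj_on_def case_prod_unfold)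
  then show ?thesis by (simp add: sum.cartesian_product)
qed

text \<open>Each factor of \<open>pilot_prob\<close> depends on all earlier states of the segment,
  so summing out a pilot law has to begin with its last state.\<close>

lemma sum_paths_snoc:
  "(\<Sum>z\<in>paths A (Suc n). f z) = (\<Sum>z\<in>paths A n. \<Sum>b\<in>A. f (z @ [b]))"
proof (induction n arbitrary: f)
  case 0
  show ?case by (simp add: sum_paths_Cons)
next
  case (Suc n)
  show ?case
    by (subst sum_paths_Cons, subst Suc.IH, subst sum_paths_Cons) simp
qed

text \<open>Given any prefix, the last proposal has total mass 1 on \<open>A\<close>, so the states
  of the segment can be summed out one at a time from the end.\<close>

lemma sum_pilot_prob:
  assumes "finite A" "x \<in> paths A (t + 1)"
    and "\<forall>s\<in>{t + 1..t + \<Delta>}. \<forall>x\<in>paths A s. set_pmf (q s x) \<subseteq> A"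
  shows "(\<Sum>z\<in>paths A \<Delta>. pilot_prob q t \<Delta> x z) = 1"
  using assms(3)
proof (induction \<Delta>)
  case 0
  then show ?case by (simp add: pilot_prob_def)
next
  case (Suc n)
  have step: "pilot_prob q t (Suc n) x (z @ [b])
      = pilot_prob q t n x z * pmf (q (t + 1 + n) (x @ z)) b" if "z \<in> paths A n" for z b
  proof -
    have len: "length z = n" using that by (simp add: paths_def)
    \<comment> \<open>For s up to t + n, neither the prefix nor the entry used by the factor reaches
      the appended state \<open>b\<close>.\<close>
    have "(\<Prod>s = t + 1..t + n. pmf (q s (x @ take (s - t - 1) (z @ [b]))) ((z @ [b]) ! (s - t - 1)))
        = pilot_prob q t n x z"
      unfolding pilot_prob_def by (rule prod.cong) (use len in \<open>auto simp: nth_append\<close>)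
    then show ?thesis
      using len by (simp add: pilot_prob_def[of q t "Suc n"] nth_append)
  qed
  have "(\<Sum>b\<in>A. pmf (q (t + 1 + n) (x @ z)) b) = 1" if "z \<in> paths A n" for z
  proof (rule sum_pmf_eq_1)
    show "set_pmf (q (t + 1 + n) (x @ z)) \<subseteq> A"
      using Suc.prems append_in_paths[OF assms(2) that] by simp
  qed fact
  then have "(\<Sum>z\<in>paths A (Suc n). pilot_prob q t (Suc n) x z)
      = (\<Sum>z\<in>paths A n. pilot_prob q t n x z)"
    by (simp add: sum_paths_snoc step flip: sum_distrib_left)
  then show ?case using Suc by simp
qed

section \<open>Posterior marginals and the mean of an incremental weight\<close>

lemma post_nonneg:
  assumes "\<And>x. x \<in> paths A (n + 1) \<Longrightarrow> 0 \<le> p n x (restrict y {1..n})"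
    and "x \<in> paths A m" "m \<le> n + 1"
  shows "0 \<le> post A p y n x"
proof -
  have "x @ z \<in> paths A (n + 1)" if "z \<in> paths A (n + 1 - length x)" for z
    using that assms(2,3) by (auto simp: paths_def)
  then show ?thesis
    unfolding post_def obs_density_def
    by (intro divide_nonneg_nonneg sum_nonneg assms(1)) auto
qed

lemma sum_post_snoc:
  assumes "x \<in> paths A m" "m \<le> n"
  shows "(\<Sum>b\<in>A. post A p y n (x @ [b])) = post A p y n x"
proof -
  \<comment> \<open>The bound \<open>m \<le> n\<close> leaves at least one state to be summed out;
    its first entry is the \<open>b\<close> of the claim.\<close>
  have "n + 1 - length x = Suc (n - m)" using assms by (auto simp: paths_def)
  moreover have "n + 1 - length (x @ [b]) = n - m" for b using assms by (auto simp: paths_def)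
  ultimately show ?thesis
    by (simp only: post_def sum_paths_Cons sum_divide_distrib append_assoc append_Cons append_Nil)
qed

lemma sum_post_append:
  assumes "x \<in> paths A m" "m + k = n + 1"
  shows "(\<Sum>z\<in>paths A k. post A p y n (x @ z)) = post A p y n x"
proof -
  have "n + 1 - length x = k" using assms by (auto simp: paths_def)
  moreover have "n + 1 - length (x @ z) = 0" if "z \<in> paths A k" for z
    using assms that by (auto simp: paths_def)
  ultimately show ?thesis
    unfolding post_def by (simp add: sum_divide_distrib)
qed

text \<open>For use where the support condition on the pilot says nothing: if \<open>x\<close> has
  zero posterior mass, its completions are nonnegative terms with sum zero.\<close>

lemma post_append_eq_0:
  assumes "finite A"
    and nonneg: "\<And>x. x \<in> paths A (n + 1) \<Longrightarrow> 0 \<le> p n x (restrict y {1..n})"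
    and x: "x \<in> paths A m" and z: "z \<in> paths A k" and mk: "m + k = n + 1"
    and "post A p y n x = 0"
  shows "post A p y n (x @ z) = 0"
proof -
  have "0 \<le> post A p y n (x @ z)" if "z \<in> paths A k" for z
    using post_nonneg[of A n p y "x @ z" "n + 1"] nonneg append_in_paths[OF x that] mk by simp
  moreover have "(\<Sum>z\<in>paths A k. post A p y n (x @ z)) = 0"
    using sum_post_append[OF x mk, of p y] assms(6) by simp
  ultimately show ?thesis
    using z finite_paths[OF assms(1)] by (simp add: sum_nonneg_eq_0_iff)
qed

text \<open>The support condition on the pilot makes the weight unbiased: no mass of the target is lost
  where the pilot probability vanishes.\<close>

lemma incr_weight_mean:
  assumes "finite A"
    and nonneg: "\<And>x. x \<in> paths A (t + \<Delta> + 1) \<Longrightarrow> 0 \<le> p (t + \<Delta>) x (restrict y {1..t + \<Delta>})"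
    and pilot: "pilot_proposal A p y t \<Delta> q"
    and x: "x \<in> paths A t" and b: "b \<in> A"
  shows "(\<Sum>z\<in>paths A \<Delta>. pilot_prob q t \<Delta> (x @ [b]) z * incr_weight A p y q t \<Delta> x b z)
    = post A p y (t + \<Delta>) (x @ [b]) / post A p y (t - 1) x"
proof -
  let ?n = "t + \<Delta>"
  have xb: "x @ [b] \<in> paths A (t + 1)" using x b by (auto simp: paths_def)
  have "pilot_prob q t \<Delta> (x @ [b]) z * incr_weight A p y q t \<Delta> x b z
      = post A p y ?n ((x @ [b]) @ z) / post A p y (t - 1) x" if z: "z \<in> paths A \<Delta>" for z
  proof (cases "pilot_prob q t \<Delta> (x @ [b]) z = 0")
    \<comment> \<open>Here the left side is zero, so the target must have no mass at this
      segment.\<close>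
    case True
    have full: "(x @ [b]) @ z \<in> paths A (?n + 1)" using append_in_paths[OF xb z] by simp
    have "post A p y ?n ((x @ [b]) @ z) = 0"
    proof (cases "post A p y ?n (x @ [b]) = 0")
      case True
      then show ?thesis
        using post_append_eq_0[where p = p and y = y and n = ?n, OF assms(1) nonneg xb z] by simp
    next
      case False
      moreover have "0 \<le> post A p y ?n (x @ [b])"
        using post_nonneg[of A ?n p y, OF nonneg xb] by simp
      ultimately have pos: "0 < post A p y ?n (x @ [b])" by simp
      \<comment> \<open>Contrapositive of the support condition, which applies because the path up
        to time t has positive posterior mass.\<close>
      with pilot xb z True have "\<not> 0 < post_cond A p y ?n (x @ [b]) z"
        unfolding pilot_proposal_def by fastforce
      then have "post A p y ?n ((x @ [b]) @ z) \<le> 0"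
        using pos by (simp add: post_cond_def zero_less_divide_iff)
      moreover have "0 \<le> post A p y ?n ((x @ [b]) @ z)"
        using post_nonneg[of A ?n p y, OF nonneg full] by simp
      ultimately show ?thesis by simp
    qed
    with True show ?thesis by simp
  next
    \<comment> \<open>The pilot probability cancels; if \<open>post A p y (t - 1) x\<close> is zero,
      both sides are zero as divisions by zero.\<close>
    case False
    then show ?thesis by (simp add: incr_weight_def)
  qed
  then have "(\<Sum>z\<in>paths A \<Delta>. pilot_prob q t \<Delta> (x @ [b]) z * incr_weight A p y q t \<Delta> x b z)
      = (\<Sum>z\<in>paths A \<Delta>. post A p y ?n ((x @ [b]) @ z)) / post A p y (t - 1) x"
    by (simp add: sum_divide_distrib)
  then show ?thesis
    using sum_post_append[OF xb, of \<Delta> ?n p y] by simp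
qed

section \<open>Moments of a sum of independent coordinates\<close>

lemma sum_PiE_insert:
  assumes "j \<notin> J"
  shows "(\<Sum>v\<in>PiE (insert j J) T. f v) = (\<Sum>b\<in>T j. \<Sum>v\<in>PiE J T. f (v(j := b)))"
  unfolding PiE_insert_eq
  by (subst sum.reindex[OF inj_combinator[OF assms]])
     (simp add: sum.cartesian_product case_prod_unfold)

text \<open>This is additivity of means and variances under independence, as an identity of finite
  sums. The three claims are proved together because expanding the square for a new coordinate calls
  on the total mass and the first moment of the old ones.\<close>

lemma product_weights_moments:
  fixes r u :: "'i \<Rightarrow> 'b \<Rightarrow> real" and T :: "'b set"
  defines "mean \<equiv> \<lambda>j. \<Sum>b\<in>T. r j b * u j b"
  assumes "finite J" and "\<And>j. j \<in> J \<Longrightarrow> (\<Sum>b\<in>T. r j b) = 1"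
  shows "(\<Sum>v\<in>J \<rightarrow>\<^sub>E T. \<Prod>j\<in>J. r j (v j)) = 1 \<and>
    (\<Sum>v\<in>J \<rightarrow>\<^sub>E T. (\<Prod>j\<in>J. r j (v j)) * (\<Sum>j\<in>J. u j (v j))) = (\<Sum>j\<in>J. mean j) \<and>
    (\<Sum>v\<in>J \<rightarrow>\<^sub>E T. (\<Prod>j\<in>J. r j (v j)) * (\<Sum>j\<in>J. u j (v j))\<^sup>2)
      = (\<Sum>j\<in>J. mean j)\<^sup>2 + (\<Sum>j\<in>J. \<Sum>b\<in>T. r j b * (u j b - mean j)\<^sup>2)"
  using assms(2,3)
proof (induction J rule: finite_induct)
  case empty
  then show ?case by simp
next
  case (insert j J)
  \<comment> \<open>In \<open>linear\<close> and \<open>quadratic\<close>, \<open>d\<close> and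
    \<open>e\<close> stand for the weight and the value of the new coordinate, \<open>R\<close> and
    \<open>U\<close> for those of the old ones.\<close>
  have linear: "(\<Sum>v\<in>S. d * R v * (e + U v)) = d * e * (\<Sum>v\<in>S. R v) + d * (\<Sum>v\<in>S. R v * U v)"
    for S :: "('i \<Rightarrow> 'b) set" and d e :: real and R U
    unfolding sum_distrib_left sum.distrib[symmetric] by (simp add: algebra_simps)
  have quadratic: "(\<Sum>v\<in>S. d * R v * (e + U v)\<^sup>2) = d * e\<^sup>2 * (\<Sum>v\<in>S. R v)
      + 2 * d * e * (\<Sum>v\<in>S. R v * U v) + d * (\<Sum>v\<in>S. R v * (U v)\<^sup>2)"
    for S :: "('i \<Rightarrow> 'b) set" and d e :: real and R U
    unfolding sum_distrib_left sum.distrib[symmetric]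
    by (simp add: algebra_simps power2_eq_square)
  let ?r = "\<lambda>v. \<Prod>i\<in>J. r i (v i)" and ?u = "\<lambda>v. \<Sum>i\<in>J. u i (v i)"
  let ?m = "\<Sum>i\<in>J. mean i" and ?V = "\<lambda>i. \<Sum>b\<in>T. r i b * (u i b - mean i)\<^sup>2"
  \<comment> \<open>Splits off coordinate \<open>j\<close> for a general \<open>F\<close>; the
    constant 1, the identity and the square give the three claims.\<close>
  have upd: "(\<Sum>v\<in>insert j J \<rightarrow>\<^sub>E T. (\<Prod>i\<in>insert j J. r i (v i)) * F (\<Sum>i\<in>insert j J. u i (v i)))
      = (\<Sum>b\<in>T. \<Sum>v\<in>J \<rightarrow>\<^sub>E T. r j b * ?r v * F (u j b + ?u v))" for F :: "real \<Rightarrow> real"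
  proof -
    have "(\<Prod>i\<in>J. r i ((v(j := b)) i)) = ?r v" "(\<Sum>i\<in>J. u i ((v(j := b)) i)) = ?u v" for v b
      using insert.hyps by (auto intro!: prod.cong sum.cong)
    then show ?thesis
      using insert.hyps by (simp add: sum_PiE_insert del: fun_upd_apply) simp
  qed
  have total: "(\<Sum>b\<in>T. r j b) = 1" using insert.prems by simp
  have IH: "(\<Sum>v\<in>J \<rightarrow>\<^sub>E T. ?r v) = 1" "(\<Sum>v\<in>J \<rightarrow>\<^sub>E T. ?r v * ?u v) = ?m"
      "(\<Sum>v\<in>J \<rightarrow>\<^sub>E T. ?r v * (?u v)\<^sup>2) = ?m\<^sup>2 + (\<Sum>i\<in>J. ?V i)"
    using insert.IH insert.prems by simp_all
  have "(\<Sum>b\<in>T. \<Sum>v\<in>J \<rightarrow>\<^sub>E T. r j b * ?r v) = 1"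
    by (simp add: IH total flip: sum_distrib_left)
  then have first: "(\<Sum>v\<in>insert j J \<rightarrow>\<^sub>E T. \<Prod>i\<in>insert j J. r i (v i)) = 1"
    using upd[of "\<lambda>_. 1"] by simp
  have "(\<Sum>v\<in>J \<rightarrow>\<^sub>E T. r j b * ?r v * (u j b + ?u v)) = r j b * u j b + r j b * ?m" for b
  proof -
    have "(\<Sum>v\<in>J \<rightarrow>\<^sub>E T. r j b * ?r v * (u j b + ?u v))
        = r j b * u j b * (\<Sum>v\<in>J \<rightarrow>\<^sub>E T. ?r v) + r j b * (\<Sum>v\<in>J \<rightarrow>\<^sub>E T. ?r v * ?u v)"
      by (rule linear)
    then show ?thesis by (simp add: IH)
  qed
  then have "(\<Sum>b\<in>T. \<Sum>v\<in>J \<rightarrow>\<^sub>E T. r j b * ?r v * (u j b + ?u v)) = mean j + ?m"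
    by (simp add: sum.distrib total mean_def flip: sum_distrib_right)
  then have second: "(\<Sum>v\<in>insert j J \<rightarrow>\<^sub>E T. (\<Prod>i\<in>insert j J. r i (v i)) * (\<Sum>i\<in>insert j J. u i (v i)))
      = mean j + ?m"
    using upd[of "\<lambda>s. s"] by simp
  \<comment> \<open>The square is centred at \<open>mean j\<close>, so that summing over
    \<open>b\<close> leaves the variance of the new coordinate and multiples of its mean and its
    total mass.\<close>
  have "(\<Sum>v\<in>J \<rightarrow>\<^sub>E T. r j b * ?r v * (u j b + ?u v)\<^sup>2)
      = r j b * (u j b - mean j)\<^sup>2 + 2 * (mean j + ?m) * (r j b * u j b)
        + (?m\<^sup>2 + (\<Sum>i\<in>J. ?V i) - (mean j)\<^sup>2) * r j b" for b
  proof -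
    have "(\<Sum>v\<in>J \<rightarrow>\<^sub>E T. r j b * ?r v * (u j b + ?u v)\<^sup>2)
        = r j b * (u j b)\<^sup>2 * (\<Sum>v\<in>J \<rightarrow>\<^sub>E T. ?r v)
          + 2 * r j b * u j b * (\<Sum>v\<in>J \<rightarrow>\<^sub>E T. ?r v * ?u v)
          + r j b * (\<Sum>v\<in>J \<rightarrow>\<^sub>E T. ?r v * (?u v)\<^sup>2)"
      by (rule quadratic)
    then show ?thesis by (simp only: IH) (simp add: algebra_simps power2_eq_square)
  qed
  then have "(\<Sum>b\<in>T. \<Sum>v\<in>J \<rightarrow>\<^sub>E T. r j b * ?r v * (u j b + ?u v)\<^sup>2)
      = ?V j + 2 * (mean j + ?m) * mean j + (?m\<^sup>2 + (\<Sum>i\<in>J. ?V i) - (mean j)\<^sup>2)"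
    by (simp add: sum.distrib total mean_def flip: sum_distrib_left)
  also have "\<dots> = (mean j + ?m)\<^sup>2 + (?V j + (\<Sum>i\<in>J. ?V i))"
    by (simp add: algebra_simps power2_eq_square)
  finally have "(\<Sum>v\<in>insert j J \<rightarrow>\<^sub>E T. (\<Prod>i\<in>insert j J. r i (v i)) * (\<Sum>i\<in>insert j J. u i (v i))\<^sup>2)
      = (mean j + ?m)\<^sup>2 + (?V j + (\<Sum>i\<in>J. ?V i))"
    using upd[of "\<lambda>s. s\<^sup>2"] by simp
  with first second insert.hyps show ?case by simp
qed

section \<open>Integration against a conditional mass function\<close>

text \<open>Restricting the measure to \<open>E\<close>, or to \<open>F\<close> with factor
  \<open>c\<close>, and pushing forward along \<open>W\<close> gives the same measure on the reals
  by \<open>law\<close>. Both sides are the integral of \<open>f\<close> against that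
  measure.\<close>

lemma (in finite_measure) integral_indicator_proportional:
  fixes f :: "real \<Rightarrow> real"
  assumes [measurable]: "W \<in> borel_measurable M" "E \<in> sets M" "F \<in> sets M" "f \<in> borel_measurable borel"
    and "0 \<le> c"
    and law: "\<And>B. B \<in> sets borel \<Longrightarrow>
      measure M (E \<inter> W -` B \<inter> space M) = measure M (F \<inter> W -` B \<inter> space M) * c"
  shows "(\<integral>\<omega>. f (W \<omega>) * indicator E \<omega> \<partial>M) = c * (\<integral>\<omega>. f (W \<omega>) * indicator F \<omega> \<partial>M)"
proof -
  have eq: "distr (density M (\<lambda>\<omega>. ennreal (indicator E \<omega>))) borel W
      = distr (density M (\<lambda>\<omega>. ennreal (c * indicator F \<omega>))) borel W"
  proof (rule measure_eqI)
    fix B assume "B \<in> sets (distr (density M (\<lambda>\<omega>. ennreal (indicator E \<omega>))) borel W)"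
    then have B [measurable]: "B \<in> sets borel" by simp
    have "emeasure (distr (density M (\<lambda>\<omega>. ennreal (indicator E \<omega>))) borel W) B
        = (\<integral>\<^sup>+\<omega>. ennreal (indicator E \<omega>) * indicator (W -` B \<inter> space M) \<omega> \<partial>M)"
      by (subst emeasure_distr, simp, simp, unfold space_density, rule emeasure_density) measurable
    also have "\<dots> = (\<integral>\<^sup>+\<omega>. indicator (E \<inter> W -` B \<inter> space M) \<omega> \<partial>M)"
      by (rule nn_integral_cong) (auto split: split_indicator)
    also have "\<dots> = ennreal (measure M (E \<inter> W -` B \<inter> space M))"
      by (simp add: emeasure_eq_measure)
    also have "\<dots> = ennreal c * (\<integral>\<^sup>+\<omega>. indicator (F \<inter> W -` B \<inter> space M) \<omega> \<partial>M)"
      using \<open>0 \<le> c\<close> by (simp add: emeasure_eq_measure law ennreal_mult mult.commute)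
    also have "\<dots> = (\<integral>\<^sup>+\<omega>. ennreal c * indicator (F \<inter> W -` B \<inter> space M) \<omega> \<partial>M)"
      by (simp add: nn_integral_cmult)
    also have "\<dots> = (\<integral>\<^sup>+\<omega>. ennreal (c * indicator F \<omega>) * indicator (W -` B \<inter> space M) \<omega> \<partial>M)"
      by (rule nn_integral_cong) (auto split: split_indicator)
    also have "\<dots> = emeasure (distr (density M (\<lambda>\<omega>. ennreal (c * indicator F \<omega>))) borel W) B"
      by (subst emeasure_distr, simp, simp, unfold space_density, rule emeasure_density[symmetric]) measurable
    finally show "emeasure (distr (density M (\<lambda>\<omega>. ennreal (indicator E \<omega>))) borel W) B
      = emeasure (distr (density M (\<lambda>\<omega>. ennreal (c * indicator F \<omega>))) borel W) B" .
  qed simp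
  have "(\<integral>\<omega>. f (W \<omega>) * indicator E \<omega> \<partial>M)
      = (\<integral>w. f w \<partial>distr (density M (\<lambda>\<omega>. ennreal (indicator E \<omega>))) borel W)"
    by (simp add: integral_distr integral_density mult.commute)
  also have "\<dots> = c * (\<integral>\<omega>. f (W \<omega>) * indicator F \<omega> \<partial>M)"
    unfolding eq using \<open>0 \<le> c\<close>
    by (simp add: integral_distr integral_density mult.commute mult.left_commute)
  finally show ?thesis .
qed

text \<open>The weights \<open>r x\<close> are the conditional mass function of \<open>V\<close> given \<open>(X, W)\<close> on \<open>X = x\<close>.\<close>

lemma (in finite_measure) integral_conditional_mass_function:
  fixes f :: "real \<Rightarrow> real" and g :: "'b \<Rightarrow> 'c \<Rightarrow> real"
  assumes X [measurable]: "X \<in> M \<rightarrow>\<^sub>M count_space S" and V [measurable]: "V \<in> M \<rightarrow>\<^sub>M count_space T"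
    and W [measurable]: "W \<in> borel_measurable M" and f [measurable]: "f \<in> borel_measurable borel"
    and "finite S" "finite T"
    and int: "integrable M (\<lambda>\<omega>. f (W \<omega>))"
    and r: "\<And>x v. x \<in> S \<Longrightarrow> v \<in> T \<Longrightarrow> 0 \<le> r x v"
    and law: "\<And>x v B. x \<in> S \<Longrightarrow> v \<in> T \<Longrightarrow> B \<in> sets borel \<Longrightarrow>
      measure M {\<omega> \<in> space M. X \<omega> = x \<and> W \<omega> \<in> B \<and> V \<omega> = v}
        = measure M {\<omega> \<in> space M. X \<omega> = x \<and> W \<omega> \<in> B} * r x v"
  shows "integrable M (\<lambda>\<omega>. f (W \<omega>) * g (X \<omega>) (V \<omega>))"
    and "(\<integral>\<omega>. f (W \<omega>) * g (X \<omega>) (V \<omega>) \<partial>M)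
      = (\<integral>\<omega>. f (W \<omega>) * (\<Sum>v\<in>T. r (X \<omega>) v * g (X \<omega>) v) \<partial>M)"
proof -
  define E where "E x v = {\<omega> \<in> space M. X \<omega> = x \<and> V \<omega> = v}" for x v
  define F where "F x = {\<omega> \<in> space M. X \<omega> = x}" for x
  have F [measurable]: "F x \<in> sets M" if "x \<in> S" for x
    using measurable_sets[OF X, of "{x}"] that
    by (simp add: F_def vimage_def Int_def conj_commute)
  have Ev: "{\<omega> \<in> space M. V \<omega> = v} \<in> sets M" if "v \<in> T" for v
    using measurable_sets[OF V, of "{v}"] that by (simp add: vimage_def Int_def conj_commute)
  have E [measurable]: "E x v \<in> sets M" if "x \<in> S" "v \<in> T" for x v
  proof -
    have "E x v = F x \<inter> {\<omega> \<in> space M. V \<omega> = v}" by (auto simp: E_def F_def)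
    then show ?thesis using F[OF that(1)] Ev[OF that(2)] by simp
  qed
  have XS: "X \<omega> \<in> S" and VT: "V \<omega> \<in> T" if "\<omega> \<in> space M" for \<omega>
    using measurable_space[OF X that] measurable_space[OF V that] by simp_all
  \<comment> \<open>Each point lies in exactly one cell \<open>E x v\<close>, on which
    \<open>g\<close> is a constant. Only the factor \<open>f (W \<omega>)\<close> stays random, and
    \<open>int\<close> controls it.\<close>
  have split1: "f (W \<omega>) * g (X \<omega>) (V \<omega>)
      = (\<Sum>x\<in>S. \<Sum>v\<in>T. g x v * (f (W \<omega>) * indicator (E x v) \<omega>))" if w: "\<omega> \<in> space M" for \<omega>
  proof -
    have "g x v * (f (W \<omega>) * indicator (E x v) \<omega>)
        = (if v = V \<omega> then if x = X \<omega> then f (W \<omega>) * g x v else 0 else 0)" for x v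
      using w by (auto simp: E_def indicator_def)
    then show ?thesis using XS[OF w] VT[OF w] \<open>finite S\<close> \<open>finite T\<close> by simp
  qed
  have split2: "f (W \<omega>) * (\<Sum>v\<in>T. r (X \<omega>) v * g (X \<omega>) v)
      = (\<Sum>x\<in>S. (\<Sum>v\<in>T. r x v * g x v) * (f (W \<omega>) * indicator (F x) \<omega>))"
    if w: "\<omega> \<in> space M" for \<omega>
  proof -
    have "(\<Sum>v\<in>T. r x v * g x v) * (f (W \<omega>) * indicator (F x) \<omega>)
        = (if x = X \<omega> then f (W \<omega>) * (\<Sum>v\<in>T. r x v * g x v) else 0)" for x
      using w by (auto simp: F_def indicator_def)
    then show ?thesis using XS[OF w] \<open>finite S\<close> by simp
  qed
  have intE: "integrable M (\<lambda>\<omega>. f (W \<omega>) * indicator (E x v) \<omega>)" if "x \<in> S" "v \<in> T" for x v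
    using integrable_real_mult_indicator[OF E[OF that] int] .
  have intF: "integrable M (\<lambda>\<omega>. f (W \<omega>) * indicator (F x) \<omega>)" if "x \<in> S" for x
    using integrable_real_mult_indicator[OF F[OF that] int] .
  show "integrable M (\<lambda>\<omega>. f (W \<omega>) * g (X \<omega>) (V \<omega>))"
    by (subst Bochner_Integration.integrable_cong[OF refl split1]) (auto intro!: integrable_sum integrable_mult_right intE)
  have "(\<integral>\<omega>. f (W \<omega>) * indicator (E x v) \<omega> \<partial>M) = r x v * (\<integral>\<omega>. f (W \<omega>) * indicator (F x) \<omega> \<partial>M)"
    if "x \<in> S" "v \<in> T" for x v
  proof (rule integral_indicator_proportional[where f = f and W = W])
    fix B :: "real set" assume "B \<in> sets borel"
    moreover have "E x v \<inter> W -` B \<inter> space M = {\<omega> \<in> space M. X \<omega> = x \<and> W \<omega> \<in> B \<and> V \<omega> = v}"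
      "F x \<inter> W -` B \<inter> space M = {\<omega> \<in> space M. X \<omega> = x \<and> W \<omega> \<in> B}"
      by (auto simp: E_def F_def)
    ultimately show "measure M (E x v \<inter> W -` B \<inter> space M)
        = measure M (F x \<inter> W -` B \<inter> space M) * r x v"
      using law that by simp
  qed (use that r E F in auto)
  then have "(\<Sum>x\<in>S. \<Sum>v\<in>T. g x v * (\<integral>\<omega>. f (W \<omega>) * indicator (E x v) \<omega> \<partial>M))
      = (\<Sum>x\<in>S. (\<Sum>v\<in>T. r x v * g x v) * (\<integral>\<omega>. f (W \<omega>) * indicator (F x) \<omega> \<partial>M))"
    by (auto simp: sum_distrib_right intro!: sum.cong)
  then show "(\<integral>\<omega>. f (W \<omega>) * g (X \<omega>) (V \<omega>) \<partial>M)
      = (\<integral>\<omega>. f (W \<omega>) * (\<Sum>v\<in>T. r (X \<omega>) v * g (X \<omega>) v) \<partial>M)"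
    by (simp add: Bochner_Integration.integral_cong[OF refl split1]
        Bochner_Integration.integral_cong[OF refl split2] Bochner_Integration.integral_sum
        intE intF integrable_mult_right integrable_sum)
qed

section \<open>The exact variance gap for K pilots\<close>

text \<open>The conditional variance of one incremental weight: the subtracted ratio is its mean by
  \<open>incr_weight_mean\<close>.\<close>

definition pilot_variance ::
  "'a set \<Rightarrow> (nat \<Rightarrow> 'a list \<Rightarrow> (nat \<Rightarrow> 'y) \<Rightarrow> real) \<Rightarrow> (nat \<Rightarrow> 'y) \<Rightarrow> (nat \<Rightarrow> 'a list \<Rightarrow> 'a pmf)
     \<Rightarrow> nat \<Rightarrow> nat \<Rightarrow> 'a list \<Rightarrow> 'a \<Rightarrow> real" where
  "pilot_variance A p y q t \<Delta> x b =
     (\<Sum>z\<in>paths A \<Delta>. pilot_prob q t \<Delta> (x @ [b]) z *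
       (incr_weight A p y q t \<Delta> x b z - post A p y (t + \<Delta>) (x @ [b]) / post A p y (t - 1) x)\<^sup>2)"

lemma pilot_prob_nonneg: "0 \<le> pilot_prob q t \<Delta> x z"
  by (simp add: pilot_prob_def prod_nonneg)

lemma pilot_variance_nonneg: "0 \<le> pilot_variance A p y q t \<Delta> x b"
  by (simp add: pilot_variance_def sum_nonneg pilot_prob_nonneg)

text \<open>Rewrites the exact lookahead quantity in terms of the means of single pilots. The chain
  rule behind it also holds at paths of zero posterior mass, where \<open>post_cond\<close> is 0/0 =
  0 and the extended paths have no mass either.\<close>

lemma cond_expect_times_ratio:
  assumes "finite A" "bij_betw a {1..card A} A"
    and nonneg: "\<And>x. x \<in> paths A (t + \<Delta> + 1) \<Longrightarrow> 0 \<le> p (t + \<Delta>) x (restrict y {1..t + \<Delta>})"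
    and x: "x \<in> paths A t"
  shows "post A p y (t + \<Delta>) x / post A p y (t - 1) x * cond_expect A p y a (t + \<Delta>) h x
    = (\<Sum>i = 1..card A. post A p y (t + \<Delta>) (x @ [a i]) / post A p y (t - 1) x * h (x @ [a i]))"
proof -
  have "post A p y (t + \<Delta>) x * post_cond A p y (t + \<Delta>) x [a i] = post A p y (t + \<Delta>) (x @ [a i])"
    if "i \<in> {1..card A}" for i
  proof (cases "post A p y (t + \<Delta>) x = 0")
    case True
    have ext: "x @ [b] \<in> paths A (t + 1)" if "b \<in> A" for b
      using x that by (auto simp: paths_def)
    have "0 \<le> post A p y (t + \<Delta>) (x @ [b])" if "b \<in> A" for b
      using post_nonneg[of A "t + \<Delta>" p y, OF nonneg ext[OF that]] by simp
    moreover have "(\<Sum>b\<in>A. post A p y (t + \<Delta>) (x @ [b])) = 0"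
      using sum_post_snoc[OF x, of "t + \<Delta>" p y] True by simp
    moreover have "a i \<in> A" using assms(2) that by (auto simp: bij_betw_def)
    ultimately have "post A p y (t + \<Delta>) (x @ [a i]) = 0"
      using \<open>finite A\<close> by (simp add: sum_nonneg_eq_0_iff)
    with True show ?thesis by simp
  qed (simp add: post_cond_def)
  then have "post A p y (t + \<Delta>) x / post A p y (t - 1) x
        * (h (x @ [a i]) * post_cond A p y (t + \<Delta>) x [a i])
      = post A p y (t + \<Delta>) (x @ [a i]) / post A p y (t - 1) x * h (x @ [a i])"
    if "i \<in> {1..card A}" for i
    using that by (simp add: mult.left_commute flip: times_divide_eq_left) (simp add: mult_ac)
  then show ?thesis
    unfolding cond_expect_def sum_distrib_left by (intro sum.cong refl)
qed

text \<open>The two estimates have the same mean, so the gap is the difference of their second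
  moments. Conditionally on path and weight, this difference is the squared weight times the
  variance of the pilot average.\<close>

lemma aux_estimate_variance_gap:
  assumes A: "finite A" and a: "bij_betw a {1..card A} A"
    and nonneg: "\<And>x. x \<in> paths A (t + \<Delta> + 1) \<Longrightarrow> 0 \<le> p (t + \<Delta>) x (restrict y {1..t + \<Delta>})"
    and "prob_space P"
    and Xs [measurable]: "Xs \<in> P \<rightarrow>\<^sub>M count_space (paths A t)"
    and W [measurable]: "W \<in> borel_measurable P"
    and W2: "integrable P (\<lambda>\<omega>. (W \<omega>)\<^sup>2)"
    and pilot: "pilot_proposal A p y t \<Delta> q"
    and draws: "pilot_draws P A a q t \<Delta> Xs W K Z" and K: "1 \<le> K"
  shows "prob_space.variance P (aux_estimate A p y a q t \<Delta> Xs W K Z h)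
      - prob_space.variance P (\<lambda>\<omega>. lookahead_weight A p y t \<Delta> Xs W \<omega>
          * cond_expect A p y a (t + \<Delta>) h (Xs \<omega>))
    = (\<integral>\<omega>. (W \<omega>)\<^sup>2 * (\<Sum>i = 1..card A. pilot_variance A p y q t \<Delta> (Xs \<omega>) (a i)
          * (h (Xs \<omega> @ [a i]))\<^sup>2) \<partial>P) / real K"
proof -
  interpret prob_space P by fact
  define J where "J = {1..card A} \<times> {1..K}"
  define T where "T = paths A \<Delta>"
  define r where "r x v = (\<Prod>(i, k)\<in>J. pilot_prob q t \<Delta> (x @ [a i]) (v (i, k)))" for x v
  \<comment> \<open>The factors \<open>h\<close> and 1/K are absorbed into \<open>u\<close>, so that
    \<open>G\<close> is a plain sum of independent coordinates.\<close>
  define u where "u x j z = incr_weight A p y q t \<Delta> x (a (fst j)) z * h (x @ [a (fst j)]) / real K"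
    for x z and j :: "nat \<times> nat"
  define G where "G x v = (\<Sum>j\<in>J. u x j (v j))" for x v
  \<comment> \<open>All pilots are packed into one finite-valued variable. The restriction to
    \<open>J\<close> makes it extensional, so its values are determined by the draws indexed by
    \<open>J\<close>.\<close>
  define V where "V \<omega> = (\<lambda>(i, k)\<in>J. Z i k \<omega>)" for \<omega>
  \<comment> \<open>For a path \<open>x\<close>, \<open>m x\<close> will be the conditional mean of
    \<open>G\<close>, and \<open>c x / real K\<close> its conditional variance.\<close>
  define c where "c x = (\<Sum>i = 1..card A. pilot_variance A p y q t \<Delta> x (a i) * (h (x @ [a i]))\<^sup>2)" for x
  define m where "m x = post A p y (t + \<Delta>) x / post A p y (t - 1) x * cond_expect A p y a (t + \<Delta>) h x"
    for x
  have finJ: "finite J" and finT: "finite T" and finX: "finite (paths A t)"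
    using finite_paths[OF A] by (simp_all add: J_def T_def)
  then have finV: "finite (J \<rightarrow>\<^sub>E T)" by (simp add: finite_PiE)
  have aA: "a i \<in> A" if "i \<in> {1..card A}" for i
    using a that by (auto simp: bij_betw_def)
  have aux: "aux_estimate A p y a q t \<Delta> Xs W K Z h \<omega> = W \<omega> * G (Xs \<omega>) (V \<omega>)" for \<omega>
  proof -
    have "G (Xs \<omega>) (V \<omega>) = (\<Sum>(i, k)\<in>J. incr_weight A p y q t \<Delta> (Xs \<omega>) (a i) (Z i k \<omega>)
        * h (Xs \<omega> @ [a i]) / real K)"
      unfolding G_def by (rule sum.cong) (auto simp: u_def V_def)
    then show ?thesis
      by (simp add: aux_estimate_def J_def sum.cartesian_product[symmetric] sum_divide_distrib)
  qed
  have look: "lookahead_weight A p y t \<Delta> Xs W \<omega> * cond_expect A p y a (t + \<Delta>) h (Xs \<omega>)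
      = W \<omega> * m (Xs \<omega>)" for \<omega>
    by (simp add: lookahead_weight_def m_def)
  have moments: "(\<Sum>v\<in>J \<rightarrow>\<^sub>E T. r x v * G x v) = m x"
    "(\<Sum>v\<in>J \<rightarrow>\<^sub>E T. r x v * (G x v)\<^sup>2) = (m x)\<^sup>2 + c x / real K" if x: "x \<in> paths A t" for x
  proof -
    let ?r = "\<lambda>(i, k) z. pilot_prob q t \<Delta> (x @ [a i]) z"
    let ?\<mu> = "\<lambda>i. post A p y (t + \<Delta>) (x @ [a i]) / post A p y (t - 1) x"
    have xi: "x @ [a i] \<in> paths A (t + 1)" if "i \<in> {1..card A}" for i
      using x aA[OF that] by (auto simp: paths_def)
    have r1: "(\<Sum>z\<in>T. ?r j z) = 1" if "j \<in> J" for j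
      using that sum_pilot_prob[OF A xi, of _ \<Delta> q] pilot
      by (auto simp: J_def T_def pilot_proposal_def)
    have rx: "r x v = (\<Prod>j\<in>J. ?r j (v j))" for v
      unfolding r_def by (rule prod.cong) auto
    have mean: "(\<Sum>z\<in>T. ?r j z * u x j z) = ?\<mu> (fst j) * h (x @ [a (fst j)]) / real K"
      if "j \<in> J" for j
    proof -
      have "(\<Sum>z\<in>T. ?r j z * u x j z) = (\<Sum>z\<in>T. pilot_prob q t \<Delta> (x @ [a (fst j)]) z
          * incr_weight A p y q t \<Delta> x (a (fst j)) z) * h (x @ [a (fst j)]) / real K"
        by (simp add: u_def case_prod_unfold sum_distrib_right sum_divide_distrib mult.assoc)
      also have "\<dots> = ?\<mu> (fst j) * h (x @ [a (fst j)]) / real K"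
        unfolding T_def
        using that aA by (subst incr_weight_mean[OF A nonneg pilot x]) (auto simp: J_def)
      finally show ?thesis .
    qed
    have sum_mean: "(\<Sum>j\<in>J. \<Sum>z\<in>T. ?r j z * u x j z) = m x"
    proof -
      have "(\<Sum>j\<in>J. \<Sum>z\<in>T. ?r j z * u x j z) = (\<Sum>(i, k)\<in>J. ?\<mu> i * h (x @ [a i]) / real K)"
        by (rule sum.cong) (auto simp: mean simp del: split_paired_All)
      \<comment> \<open>The K equal terms for each \<open>i\<close> absorb the factor 1/K, which
        requires K to be nonzero.\<close>
      also have "\<dots> = (\<Sum>i = 1..card A. ?\<mu> i * h (x @ [a i]))"
        using K by (simp add: J_def sum.cartesian_product[symmetric])
      finally show ?thesis
        using cond_expect_times_ratio[where p = p and y = y and h = h, OF A a nonneg x]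
        by (simp only: m_def)
    qed
    have var: "(\<Sum>z\<in>T. ?r j z * (u x j z - (\<Sum>z\<in>T. ?r j z * u x j z))\<^sup>2)
        = pilot_variance A p y q t \<Delta> x (a (fst j)) * (h (x @ [a (fst j)]))\<^sup>2 / (real K)\<^sup>2"
      if "j \<in> J" for j
    proof -
      have "u x j z - (\<Sum>z\<in>T. ?r j z * u x j z)
          = (incr_weight A p y q t \<Delta> x (a (fst j)) z - ?\<mu> (fst j)) * (h (x @ [a (fst j)]) / real K)" for z
        unfolding mean[OF that]
        by (simp add: u_def case_prod_unfold left_diff_distrib diff_divide_distrib)
      then show ?thesis
        by (simp add: pilot_variance_def T_def case_prod_unfold power_mult_distrib power_divide
            sum_distrib_right sum_divide_distrib mult.assoc)
    qed
    have sum_var: "(\<Sum>j\<in>J. \<Sum>z\<in>T. ?r j z * (u x j z - (\<Sum>z\<in>T. ?r j z * u x j z))\<^sup>2) = c x / real K"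
    proof -
      have "(\<Sum>j\<in>J. \<Sum>z\<in>T. ?r j z * (u x j z - (\<Sum>z\<in>T. ?r j z * u x j z))\<^sup>2)
          = (\<Sum>(i, k)\<in>J. pilot_variance A p y q t \<Delta> x (a i) * (h (x @ [a i]))\<^sup>2 / (real K)\<^sup>2)"
        by (rule sum.cong[OF refl], subst var) (auto simp: case_prod_unfold)
      \<comment> \<open>For each \<open>i\<close> there are K equal terms with denominator
        \<open>(real K)\<^sup>2\<close>.\<close>
      also have "\<dots> = c x / real K"
        using K by (simp add: J_def c_def sum.cartesian_product[symmetric] sum_divide_distrib
            power2_eq_square)
      finally show ?thesis .
    qed
    show "(\<Sum>v\<in>J \<rightarrow>\<^sub>E T. r x v * G x v) = m x"
      using product_weights_moments[where r = ?r and u = "u x", OF finJ r1]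
      unfolding rx G_def sum_mean by simp
    show "(\<Sum>v\<in>J \<rightarrow>\<^sub>E T. r x v * (G x v)\<^sup>2) = (m x)\<^sup>2 + c x / real K"
      using product_weights_moments[where r = ?r and u = "u x", OF finJ r1]
      unfolding rx G_def sum_mean sum_var by simp
  qed
  have Zmeas: "Z i k \<in> P \<rightarrow>\<^sub>M count_space T" if "(i, k) \<in> J" for i k
    using draws that by (auto simp: pilot_draws_def J_def T_def)
  have ZT: "Z i k \<omega> \<in> T" if "\<omega> \<in> space P" "(i, k) \<in> J" for i k \<omega>
    using measurable_space[OF Zmeas] that by simp
  have V_eq: "V \<omega> = v \<longleftrightarrow> (\<forall>i\<in>{1..card A}. \<forall>k\<in>{1..K}. Z i k \<omega> = v (i, k))"
    if "v \<in> J \<rightarrow>\<^sub>E T" for v \<omega>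
    using that by (auto simp: V_def J_def fun_eq_iff PiE_def extensional_def)
  have Vm [measurable]: "V \<in> P \<rightarrow>\<^sub>M count_space (J \<rightarrow>\<^sub>E T)"
  proof (subst measurable_count_space_eq2[OF finV], intro conjI ballI)
    show "V \<in> space P \<rightarrow> (J \<rightarrow>\<^sub>E T)"
      using ZT by (auto simp: V_def)
  next
    fix v assume v: "v \<in> J \<rightarrow>\<^sub>E T"
    have "{\<omega> \<in> space P. \<forall>j\<in>J. Z (fst j) (snd j) \<omega> = v j} \<in> sets P"
    proof (rule sets.sets_Collect_finite_All[OF _ finJ])
      fix j assume "j \<in> J"
      then show "{\<omega> \<in> space P. Z (fst j) (snd j) \<omega> = v j} \<in> sets P"
        using measurable_sets[OF Zmeas[of "fst j" "snd j"], of "{v j}"] v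
        by (auto simp: vimage_def Int_def conj_commute)
    qed
    also have "{\<omega> \<in> space P. \<forall>j\<in>J. Z (fst j) (snd j) \<omega> = v j} = V -` {v} \<inter> space P"
      using V_eq[OF v] by (auto simp: J_def)
    finally show "V -` {v} \<inter> space P \<in> sets P" .
  qed
  have law: "prob {\<omega> \<in> space P. Xs \<omega> = x \<and> W \<omega> \<in> B \<and> V \<omega> = v}
      = prob {\<omega> \<in> space P. Xs \<omega> = x \<and> W \<omega> \<in> B} * r x v"
    if "x \<in> paths A t" "v \<in> J \<rightarrow>\<^sub>E T" "B \<in> sets borel" for x v B
  proof -
    have "\<forall>i\<in>{1..card A}. \<forall>k\<in>{1..K}. v (i, k) \<in> paths A \<Delta>"
      using that(2) by (auto simp: J_def T_def)
    then have "prob {\<omega> \<in> space P. Xs \<omega> = x \<and> W \<omega> \<in> B \<and>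
          (\<forall>i\<in>{1..card A}. \<forall>k\<in>{1..K}. Z i k \<omega> = v (i, k))}
        = prob {\<omega> \<in> space P. Xs \<omega> = x \<and> W \<omega> \<in> B}
          * (\<Prod>i = 1..card A. \<Prod>k = 1..K. pilot_prob q t \<Delta> (x @ [a i]) (v (i, k)))"
      using draws that(1,3) unfolding pilot_draws_def by (elim conjE) (drule (1) bspec, simp)
    then show ?thesis
      by (simp only: V_eq[OF that(2)] r_def J_def prod.cartesian_product)
  qed
  have r0: "0 \<le> r x v" for x v
    unfolding r_def by (auto intro!: prod_nonneg pilot_prob_nonneg)
  have W1: "integrable P W"
    using square_integrable_imp_integrable[OF W W2] .
  \<comment> \<open>\<open>mass1\<close> serves the first moment and \<open>mass2\<close> the
    second; path and pilots enter through the free function \<open>g\<close>.\<close>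
  note mass1 = integral_conditional_mass_function[where f = "\<lambda>w. w" and r = r,
      OF Xs Vm W _ finX finV _ r0 law]
  note mass2 = integral_conditional_mass_function[where f = "\<lambda>w. w\<^sup>2" and r = r,
      OF Xs Vm W _ finX finV _ r0 law]
  have XsS: "Xs \<omega> \<in> paths A t" if "\<omega> \<in> space P" for \<omega>
    using measurable_space[OF Xs that] by simp
  \<comment> \<open>A function of \<open>Xs\<close> takes finitely many values, hence is bounded by
    the sum of their absolute values.\<close>
  have bounded: "integrable P (\<lambda>\<omega>. w (W \<omega>) * g (Xs \<omega>))"
    if "integrable P (\<lambda>\<omega>. w (W \<omega>))" for w :: "real \<Rightarrow> real" and g :: "'a list \<Rightarrow> real"
  proof -
    let ?S = "\<Sum>x\<in>paths A t. \<bar>g x\<bar>"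
    have meas: "(\<lambda>\<omega>. g (Xs \<omega>)) \<in> borel_measurable P"
      by (rule measurable_compose[OF Xs]) simp
    have le: "norm (w (W \<omega>) * g (Xs \<omega>)) \<le> norm (?S * w (W \<omega>))" if "\<omega> \<in> space P" for \<omega>
    proof -
      have "\<bar>g (Xs \<omega>)\<bar> \<le> ?S"
        using finX XsS[OF that] by (intro member_le_sum) auto
      then have "\<bar>g (Xs \<omega>)\<bar> * \<bar>w (W \<omega>)\<bar> \<le> ?S * \<bar>w (W \<omega>)\<bar>"
        by (rule mult_right_mono) simp
      then show ?thesis
        by (simp add: abs_mult sum_nonneg mult.commute)
    qed
    show ?thesis
      by (rule Bochner_Integration.integrable_bound[OF integrable_mult_right[OF that, of ?S]])
        (use that meas le in auto)
  qed
  have E1: "expectation (\<lambda>\<omega>. W \<omega> * G (Xs \<omega>) (V \<omega>)) = expectation (\<lambda>\<omega>. W \<omega> * m (Xs \<omega>))"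
  proof -
    have "expectation (\<lambda>\<omega>. W \<omega> * G (Xs \<omega>) (V \<omega>))
        = expectation (\<lambda>\<omega>. W \<omega> * (\<Sum>v\<in>J \<rightarrow>\<^sub>E T. r (Xs \<omega>) v * G (Xs \<omega>) v))"
      using W1 by (intro mass1(2)) simp_all
    also have "\<dots> = expectation (\<lambda>\<omega>. W \<omega> * m (Xs \<omega>))"
      by (rule Bochner_Integration.integral_cong) (simp_all add: moments(1) XsS)
    finally show ?thesis .
  qed
  have E2: "expectation (\<lambda>\<omega>. (W \<omega> * G (Xs \<omega>) (V \<omega>))\<^sup>2)
      = expectation (\<lambda>\<omega>. (W \<omega> * m (Xs \<omega>))\<^sup>2) + expectation (\<lambda>\<omega>. (W \<omega>)\<^sup>2 * c (Xs \<omega>)) / real K"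
  proof -
    have "expectation (\<lambda>\<omega>. (W \<omega> * G (Xs \<omega>) (V \<omega>))\<^sup>2)
        = expectation (\<lambda>\<omega>. (W \<omega>)\<^sup>2 * (\<Sum>v\<in>J \<rightarrow>\<^sub>E T. r (Xs \<omega>) v * (G (Xs \<omega>) v)\<^sup>2))"
      unfolding power_mult_distrib using W2 by (intro mass2(2)) simp_all
    also have "\<dots> = expectation (\<lambda>\<omega>. (W \<omega>)\<^sup>2 * (m (Xs \<omega>))\<^sup>2 + (W \<omega>)\<^sup>2 * c (Xs \<omega>) / real K)"
      by (rule Bochner_Integration.integral_cong) (auto simp: moments(2) XsS distrib_left)
    also have "\<dots> = expectation (\<lambda>\<omega>. (W \<omega>)\<^sup>2 * (m (Xs \<omega>))\<^sup>2)
        + expectation (\<lambda>\<omega>. (W \<omega>)\<^sup>2 * c (Xs \<omega>)) / real K"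
      using bounded[of "\<lambda>w. w\<^sup>2", OF W2] by (subst Bochner_Integration.integral_add) auto
    finally show ?thesis by (simp add: power_mult_distrib)
  qed
  have v1: "variance (\<lambda>\<omega>. W \<omega> * G (Xs \<omega>) (V \<omega>))
      = expectation (\<lambda>\<omega>. (W \<omega> * G (Xs \<omega>) (V \<omega>))\<^sup>2) - (expectation (\<lambda>\<omega>. W \<omega> * G (Xs \<omega>) (V \<omega>)))\<^sup>2"
  proof (rule variance_eq)
    show "integrable P (\<lambda>\<omega>. W \<omega> * G (Xs \<omega>) (V \<omega>))"
      using W1 by (intro mass1(1)) simp_all
    show "integrable P (\<lambda>\<omega>. (W \<omega> * G (Xs \<omega>) (V \<omega>))\<^sup>2)"
      unfolding power_mult_distrib using W2 by (intro mass2(1)) simp_all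
  qed
  have v2: "variance (\<lambda>\<omega>. W \<omega> * m (Xs \<omega>))
      = expectation (\<lambda>\<omega>. (W \<omega> * m (Xs \<omega>))\<^sup>2) - (expectation (\<lambda>\<omega>. W \<omega> * m (Xs \<omega>)))\<^sup>2"
    using bounded[of "\<lambda>w. w", OF W1] bounded[of "\<lambda>w. w\<^sup>2" "\<lambda>x. (m x)\<^sup>2", OF W2]
    by (intro variance_eq) (simp_all add: power_mult_distrib)
  have "variance (\<lambda>\<omega>. W \<omega> * G (Xs \<omega>) (V \<omega>)) - variance (\<lambda>\<omega>. W \<omega> * m (Xs \<omega>))
      = expectation (\<lambda>\<omega>. (W \<omega>)\<^sup>2 * c (Xs \<omega>)) / real K"
    using v1 v2 E2 unfolding E1 by linarith
  then show ?thesis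
    unfolding look c_def by (simp only: aux[abs_def])
qed

(* P is the law of the Monte Carlo sampling conditional on the observations y 1, ..., y (t + \<Delta>).
   Xs and W are the sample path (x_0, ..., x_(t-1)) and its weight, and Z K i k are the pilots of
   the algorithm run with K pilots per state; nothing is assumed about how the runs for different
   K are coupled. *)

theorem proposition5:
  fixes M :: "'w measure" and A :: "'a set" and \<nu> :: "nat \<Rightarrow> 'y measure"
    and X :: "nat \<Rightarrow> 'w \<Rightarrow> 'a" and Y :: "nat \<Rightarrow> 'w \<Rightarrow> 'y"
    and p :: "nat \<Rightarrow> 'a list \<Rightarrow> (nat \<Rightarrow> 'y) \<Rightarrow> real"
    and y :: "nat \<Rightarrow> 'y" and a :: "nat \<Rightarrow> 'a" and t \<Delta> :: nat
    and P :: "'v measure" and Xs :: "'v \<Rightarrow> 'a list" and W :: "'v \<Rightarrow> real"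
    and q :: "nat \<Rightarrow> 'a list \<Rightarrow> 'a pmf"
    and Z :: "nat \<Rightarrow> nat \<Rightarrow> nat \<Rightarrow> 'v \<Rightarrow> 'a list"
  assumes "state_space_model M A \<nu> X Y p"
    and "bij_betw a {1..card A} A"
    and "1 \<le> t"
    and "\<And>s. s \<in> {1..t + \<Delta>} \<Longrightarrow> y s \<in> space (\<nu> s)"
    and "0 < obs_density A p y (t - 1)" and "0 < obs_density A p y (t + \<Delta>)"
    and "prob_space P"
    and "properly_weighted P (paths A t) (post A p y (t - 1)) Xs W"
    and "integrable P (\<lambda>\<omega>. (W \<omega>)\<^sup>2)"
    and "pilot_proposal A p y t \<Delta> q"
    and "\<And>K. 1 \<le> K \<Longrightarrow> pilot_draws P A a q t \<Delta> Xs W K (Z K)"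
  shows "((\<forall>K\<ge>1. 0 \<le> prob_space.variance P (aux_weight A p y a q t \<Delta> Xs W K (Z K))
                    - prob_space.variance P (lookahead_weight A p y t \<Delta> Xs W)) \<and>
          (\<lambda>K. prob_space.variance P (aux_weight A p y a q t \<Delta> Xs W K (Z K))
                    - prob_space.variance P (lookahead_weight A p y t \<Delta> Xs W))
            \<in> O(\<lambda>K. 1 / real K)) \<and>
         (\<forall>h :: 'a list \<Rightarrow> real.
          (\<forall>K\<ge>1. 0 \<le> prob_space.variance P (aux_estimate A p y a q t \<Delta> Xs W K (Z K) h)
                    - prob_space.variance P (\<lambda>\<omega>. lookahead_weight A p y t \<Delta> Xs W \<omega>
                        * cond_expect A p y a (t + \<Delta>) h (Xs \<omega>))) \<and>
          (\<lambda>K. prob_space.variance P (aux_estimate A p y a q t \<Delta> Xs W K (Z K) h)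
                    - prob_space.variance P (\<lambda>\<omega>. lookahead_weight A p y t \<Delta> Xs W \<omega>
                        * cond_expect A p y a (t + \<Delta>) h (Xs \<omega>)))
            \<in> O(\<lambda>K. 1 / real K))"
proof -
  interpret P: prob_space P by fact
  let ?n = "t + \<Delta>"
  have A: "finite A"
    using assms(1) by (rule state_space_model.finite_states)
  have nonneg: "0 \<le> p ?n x (restrict y {1..?n})" if "x \<in> paths A (?n + 1)" for x
    using state_space_model.density_nonneg[OF assms(1) that] assms(4) by (simp add: space_PiM)
  have Xs: "Xs \<in> P \<rightarrow>\<^sub>M count_space (paths A t)" and W: "W \<in> borel_measurable P"
    using assms(8) by (auto simp: properly_weighted_def)
  have estimate: "(\<forall>K\<ge>1. 0 \<le> P.variance (aux_estimate A p y a q t \<Delta> Xs W K (Z K) h)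
                    - P.variance (\<lambda>\<omega>. lookahead_weight A p y t \<Delta> Xs W \<omega>
                        * cond_expect A p y a ?n h (Xs \<omega>))) \<and>
          (\<lambda>K. P.variance (aux_estimate A p y a q t \<Delta> Xs W K (Z K) h)
                    - P.variance (\<lambda>\<omega>. lookahead_weight A p y t \<Delta> Xs W \<omega>
                        * cond_expect A p y a ?n h (Xs \<omega>)))
            \<in> O(\<lambda>K. 1 / real K)" (is "(\<forall>K\<ge>1. 0 \<le> ?d K) \<and> _") for h
  proof -
    \<comment> \<open>The numerator of the gap; the draws \<open>Z K\<close> do not occur in it, so
      it is fixed before K varies.\<close>
    define C where "C = (\<integral>\<omega>. (W \<omega>)\<^sup>2 * (\<Sum>i = 1..card A.
      pilot_variance A p y q t \<Delta> (Xs \<omega>) (a i) * (h (Xs \<omega> @ [a i]))\<^sup>2) \<partial>P)"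
    have C: "0 \<le> C"
      unfolding C_def
      by (intro integral_nonneg_AE AE_I2 mult_nonneg_nonneg sum_nonneg pilot_variance_nonneg) auto
    have d: "?d K = C / real K" if "1 \<le> K" for K
      unfolding C_def
      using aux_estimate_variance_gap[OF A assms(2) nonneg assms(7) Xs W assms(9,10,11)] that by simp
    \<comment> \<open>The identity \<open>d\<close> starts at K = 1, so the bound is claimed
      eventually, with \<open>C\<close> itself as the constant.\<close>
    have "?d \<in> O(\<lambda>K. 1 / real K)"
      by (rule bigoI[where c = C], rule eventually_sequentiallyI[of 1]) (use C d in simp)
    then show ?thesis using C d by simp
  qed
  \<comment> \<open>The claim on the weights is the case where \<open>h\<close> is constantly
    1.\<close>
  have aux: "aux_weight A p y a q t \<Delta> Xs W K (Z K)
      = aux_estimate A p y a q t \<Delta> Xs W K (Z K) (\<lambda>_. 1)" for K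
    by (simp add: fun_eq_iff aux_weight_def aux_estimate_def)
  \<comment> \<open>Conditional probabilities sum to 1 only at paths of positive posterior mass;
    elsewhere both sides vanish. As \<open>Xs\<close> is known to be a path only on
    \<open>space P\<close>, the variances are compared under the integral and not as
    functions.\<close>
  have look: "lookahead_weight A p y t \<Delta> Xs W \<omega>
      = lookahead_weight A p y t \<Delta> Xs W \<omega> * cond_expect A p y a ?n (\<lambda>_. 1) (Xs \<omega>)"
    if "\<omega> \<in> space P" for \<omega>
  proof -
    have x: "Xs \<omega> \<in> paths A t" using measurable_space[OF Xs that] by simp
    have "(\<Sum>i = 1..card A. post A p y ?n (Xs \<omega> @ [a i])) = post A p y ?n (Xs \<omega>)"
      using sum.reindex_bij_betw[OF assms(2), of "\<lambda>b. post A p y ?n (Xs \<omega> @ [b])"]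
        sum_post_snoc[OF x, of ?n] by simp
    then have "post A p y ?n (Xs \<omega>) / post A p y (t - 1) (Xs \<omega>) * cond_expect A p y a ?n (\<lambda>_. 1) (Xs \<omega>)
        = post A p y ?n (Xs \<omega>) / post A p y (t - 1) (Xs \<omega>)"
      using cond_expect_times_ratio[where p = p and h = "\<lambda>_. 1", OF A assms(2) nonneg x]
      by (simp flip: sum_divide_distrib)
    then show ?thesis
      by (simp only: lookahead_weight_def mult.assoc)
  qed
  have mean: "P.expectation (lookahead_weight A p y t \<Delta> Xs W) = P.expectation
      (\<lambda>\<omega>. lookahead_weight A p y t \<Delta> Xs W \<omega> * cond_expect A p y a ?n (\<lambda>_. 1) (Xs \<omega>))"
    by (rule Bochner_Integration.integral_cong[OF refl look])
  have var: "P.variance (lookahead_weight A p y t \<Delta> Xs W)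
      = P.variance (\<lambda>\<omega>. lookahead_weight A p y t \<Delta> Xs W \<omega> * cond_expect A p y a ?n (\<lambda>_. 1) (Xs \<omega>))"
    unfolding mean by (rule Bochner_Integration.integral_cong[OF refl]) (simp only: look[symmetric])
  show ?thesis
    unfolding aux var by (intro conjI[OF estimate] allI estimate)
qed

end
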